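(* For every $p\in(1,2]$ and all $x\in(0,\pi_p/2]$, $$\frac{\sin_p(x)}{x}<\frac{\cos_p(x)+p}{1+p}\le\frac{\cos_p(x)+2}{3}.$$
   Context: For $1<p<\infty$ define $\arcsin_p(x)=\int_0^x (1-t^p)^{-1/p}\,dt$ for $0\le x\le 1$, and $\pi_p/2=\arcsin_p(1)$. The generalized sine $\sin_p:[0,\pi_p/2]\to[0,1]$ is the inverse of $\arcsin_p$, and the generalized cosine is $\cos_p(x)=\frac{d}{dx}\sin_p(x)=(1-\sin_p(x)^p)^{1/p}$ on $[0,\pi_p/2]$. *)

theory Defs
  imports "HOL-Analysis.Analysis"
begin

text \<open>
  The integrand is unbounded as \<open>t\<close> tends to 1 from the left.  It is integrable on \<open>{0..1}\<close>
  for \<open>p > 1\<close>, and its value at \<open>t = 1\<close>, where \<open>0 powr a = 0\<close>, does not affect the integral.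
\<close>

definition arcsin_gen :: "real \<Rightarrow> real \<Rightarrow> real" where
  "arcsin_gen p x = integral {0..x} (\<lambda>t. (1 - t powr p) powr (- 1 / p))"

definition pi_gen :: "real \<Rightarrow> real" where
  "pi_gen p = 2 * arcsin_gen p 1"

definition sin_gen :: "real \<Rightarrow> real \<Rightarrow> real" where
  "sin_gen p = inv_into {0..1} (arcsin_gen p)"

text \<open>
  The function \<open>sin_gen p\<close> is meaningful only on \<open>{0..pi_gen p / 2}\<close>, so the derivative is taken
  within that interval; at the two endpoints it is the one-sided derivative.
\<close>

definition cos_gen :: "real \<Rightarrow> real \<Rightarrow> real" where
  "cos_gen p x = vector_derivative (sin_gen p) (at x within {0..pi_gen p / 2})"

end

theory Submission imports Defs begin

text \<open>
  Put \<open>s = sin_gen p x\<close> and \<open>c = (1 - s powr p) powr (1 / p) = cos_gen p x\<close>.  The strict inequality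
  says that \<open>F s = arcsin_gen p s - (1 + p) * s / (c + p)\<close> is positive.  As \<open>F 0 = 0\<close>, it suffices
  that \<open>F\<close> is strictly increasing, and \<open>F' s > 0\<close> unfolds to
  \<open>(1 + p) * (p * c + c powr (2 - p)) < (c + p)^2\<close>.  Since \<open>0 \<le> 2 - p < 1\<close>, Bernoulli's inequality
  \<open>c powr (2 - p) \<le> 1 + (2 - p) * (c - 1)\<close> bounds the difference of the two sides from below
  by \<open>(1 - c)^2\<close>.
\<close>

section \<open>The cosine as a function of the sine\<close>

definition cosine_of_sine :: "real \<Rightarrow> real \<Rightarrow> real" where
  "cosine_of_sine p s = (1 - s powr p) powr (1 / p)"

lemma integrand_eq: "(1 - t powr p) powr (- 1 / p) = inverse (cosine_of_sine p t)"
  using powr_minus[of "1 - t powr p" "1 / p"] by (simp add: cosine_of_sine_def)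

lemma powr_le_one: "(t::real) powr p \<le> 1" if "0 \<le> t" "t \<le> 1" "1 < p"
  using powr_mono2[of p t 1] that by simp

lemma cosine_of_sine_nonneg: "0 \<le> cosine_of_sine p s"
  by (simp add: cosine_of_sine_def)

lemma cosine_of_sine_antimono:
  assumes "1 < p" "0 \<le> s" "s \<le> t" "t \<le> 1"
  shows "cosine_of_sine p t \<le> cosine_of_sine p s"
  unfolding cosine_of_sine_def
  using assms powr_le_one[of t p] by (intro powr_mono2) (auto intro: powr_mono2)

lemma cosine_of_sine_pos:
  assumes "1 < p" "0 \<le> s" "s < 1"
  shows "0 < cosine_of_sine p s"
  using assms powr_less_mono2[of p s 1] by (auto simp: cosine_of_sine_def)

lemma cosine_of_sine_less_one:
  assumes "1 < p" "0 < s" "s \<le> 1"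
  shows "cosine_of_sine p s < 1"
  using assms powr_less_mono2[of "1 / p" "1 - s powr p" 1] powr_le_one[of s p]
  by (auto simp: cosine_of_sine_def)

lemma continuous_on_cosine_of_sine:
  assumes "1 < p"
  shows "continuous_on {0..1} (cosine_of_sine p)"
  unfolding cosine_of_sine_def
  using assms by (intro continuous_on_powr' continuous_intros) (auto simp: powr_le_one)

section \<open>The arcsine integral: convergence, derivative and monotonicity\<close>

lemma integrable_integrand:
  assumes p: "1 < (p::real)"
  shows "(\<lambda>t. (1 - t powr p) powr (- 1 / p)) integrable_on {0..1}"
proof (rule measurable_bounded_by_integrable_imp_integrable_real)
  \<comment> \<open>The dominating function is \<open>(1 - t) powr (- 1 / p)\<close>. Its
    antiderivative \<open>- ((1 - t) powr q / q)\<close> stays continuous at \<open>t = 1\<close>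
    because \<open>q > 0\<close>.\<close>
  define q where "q = 1 - 1 / p"
  have q: "q > 0" using p by (simp add: q_def)
  have "((\<lambda>t. (1 - t) powr (- 1 / p)) has_integral
      (- ((1 - 1) powr q / q) - - ((1 - 0) powr q / q))) {0..1}"
  proof (rule fundamental_theorem_of_calculus_interior)
    show "continuous_on {0..1} (\<lambda>t. - ((1 - t) powr q / q))"
      using q by (intro continuous_intros continuous_on_powr') auto
    fix t :: real assume t: "t \<in> {0<..<1}"
    have "((\<lambda>t. - ((1 - t) powr q / q)) has_real_derivative (1 - t) powr (- 1 / p)) (at t)"
      using t q by (auto intro!: derivative_eq_intros) (simp add: q_def)
    then show "((\<lambda>t. - ((1 - t) powr q / q)) has_vector_derivative (1 - t) powr (- 1 / p)) (at t)"
      by (simp add: has_real_derivative_iff_has_vector_derivative)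
  qed simp
  then show "(\<lambda>t. (1 - t) powr (- 1 / p)) integrable_on {0..1}"
    by blast
next
  show "(\<lambda>t. (1 - t powr p) powr (- 1 / p)) \<in> borel_measurable (lebesgue_on {0..1})"
  proof -
    have "(\<lambda>t. (1 - t powr p) powr (- 1 / p)) \<in> borel_measurable borel"
      by measurable
    then show ?thesis
      by (intro measurable_restrict_space1 measurable_completion) simp
  qed
  show "\<bar>(1 - t powr p) powr (- 1 / p)\<bar> \<le> (1 - t) powr (- 1 / p)" if "t \<in> {0..1}" for t
  \<comment> \<open>In the interior the bound follows from \<open>t powr p \<le> t\<close> and a
    negative exponent. At \<open>t = 0\<close> both sides are 1; at \<open>t = 1\<close> both are 0,
    since \<open>0 powr a = 0\<close>.\<close>
  proof (cases "t = 0 \<or> t = 1")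
    case False
    then have "t powr p \<le> t"
      using that p by (intro powr_le_one_le) auto
    then show ?thesis
      using False that p by (auto intro!: powr_mono2')
  qed auto
qed simp

lemma continuous_on_arcsin_gen:
  assumes "1 < p"
  shows "continuous_on {0..1} (arcsin_gen p)"
  unfolding arcsin_gen_def
  by (rule indefinite_integral_continuous_1[OF integrable_integrand[OF assms]])

lemma arcsin_gen_0 [simp]: "arcsin_gen p 0 = 0"
  by (simp add: arcsin_gen_def)

text \<open>The integrand is unbounded near 1, so the fundamental theorem of calculus is applied on
  \<open>{0..b}\<close> with \<open>s < b < 1\<close>, where the integrand is continuous and
  \<open>s\<close> is an interior point.\<close>

lemma DERIV_arcsin_gen:
  assumes p: "1 < p" and s: "0 < s" "s < 1"
  shows "(arcsin_gen p has_real_derivative inverse (cosine_of_sine p s)) (at s)"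
proof -
  define b where "b = (s + 1) / 2"
  have b: "s < b" "b < 1" using s by (auto simp: b_def)
  have "continuous_on {0..b} (\<lambda>t. inverse (cosine_of_sine p t))"
    using b p cosine_of_sine_pos[of p]
    by (intro continuous_on_inverse continuous_on_subset[OF continuous_on_cosine_of_sine])
       (auto simp: less_imp_neq[symmetric] dest!: order.strict_trans1)
  from integral_has_real_derivative[OF this, of s]
  have "(arcsin_gen p has_real_derivative inverse (cosine_of_sine p s)) (at s within {0..b})"
    using s b unfolding arcsin_gen_def[abs_def] integrand_eq by simp
  moreover have "at s within {0..b} = at s"
    using s b by (intro at_within_interior) auto
  ultimately show ?thesis by simp
qed

lemma strict_mono_on_arcsin_gen:
  assumes "1 < p"
  shows "strict_mono_on {0..1} (arcsin_gen p)"
proof (rule strict_mono_onI)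
  fix a b :: real assume ab: "a \<in> {0..1}" "b \<in> {0..1}" "a < b"
  show "arcsin_gen p a < arcsin_gen p b"
  proof (rule DERIV_pos_imp_increasing_open[OF \<open>a < b\<close>])
    show "\<exists>y. (arcsin_gen p has_real_derivative y) (at t) \<and> 0 < y" if "a < t" "t < b" for t
      using DERIV_arcsin_gen[of p t] cosine_of_sine_pos[of p t] assms ab that by force
    show "continuous_on {a..b} (arcsin_gen p)"
      using ab by (intro continuous_on_subset[OF continuous_on_arcsin_gen[OF assms]]) auto
  qed
qed

text \<open>
  These difference quotient bounds are free of division by \<open>cosine_of_sine p b\<close>, so they include
  the right endpoint \<open>b = 1\<close>, where it vanishes.
\<close>

lemma arcsin_gen_diff_bounds:
  assumes p: "1 < p" and ab: "0 \<le> a" "a < b" "b \<le> 1"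
  shows "cosine_of_sine p b * (arcsin_gen p b - arcsin_gen p a) \<le> b - a"
    and "b - a \<le> cosine_of_sine p a * (arcsin_gen p b - arcsin_gen p a)"
proof -
  \<comment> \<open>The mean value theorem asks for the derivative only strictly between
    \<open>a\<close> and \<open>b\<close>, which is why \<open>b = 1\<close> is allowed.\<close>
  have "\<exists>t>a. t < b \<and> arcsin_gen p b - arcsin_gen p a = (b - a) * inverse (cosine_of_sine p t)"
  proof (rule exE[OF mvt[OF \<open>a < b\<close>, of "arcsin_gen p" "\<lambda>t h. h * inverse (cosine_of_sine p t)"]])
    show "continuous_on {a..b} (arcsin_gen p)"
      using ab by (intro continuous_on_subset[OF continuous_on_arcsin_gen[OF p]]) auto
    show "(arcsin_gen p has_derivative (\<lambda>h. h * inverse (cosine_of_sine p t))) (at t)"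
      if "a < t" "t < b" for t
      using DERIV_arcsin_gen[OF p, of t] that ab
      by (simp add: has_field_derivative_def mult.commute[of _ "inverse _"])
  qed auto
  then obtain t where t: "a < t" "t < b"
    and eq: "arcsin_gen p b - arcsin_gen p a = (b - a) * inverse (cosine_of_sine p t)"
    by blast
  have ct: "0 < cosine_of_sine p t" "cosine_of_sine p b \<le> cosine_of_sine p t"
    "cosine_of_sine p t \<le> cosine_of_sine p a"
    using cosine_of_sine_pos cosine_of_sine_antimono p ab t by auto
  show "cosine_of_sine p b * (arcsin_gen p b - arcsin_gen p a) \<le> b - a"
    "b - a \<le> cosine_of_sine p a * (arcsin_gen p b - arcsin_gen p a)"
    using mult_left_mono[OF ct(2), of "b - a"] mult_left_mono[OF ct(3), of "b - a"] ct(1) ab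
    unfolding eq by (simp_all add: divide_simps mult.commute)
qed

lemma bij_betw_arcsin_gen:
  assumes p: "1 < p"
  shows "bij_betw (arcsin_gen p) {0..1} {0..pi_gen p / 2}"
proof -
  have mono: "arcsin_gen p s \<le> arcsin_gen p t" if "0 \<le> s" "s \<le> t" "t \<le> 1" for s t
    using strict_mono_onD[OF strict_mono_on_arcsin_gen[OF p], of s t] that
    by (cases "s = t") auto
  have "{0..arcsin_gen p 1} \<subseteq> arcsin_gen p ` {0..1}"
    using IVT'[of "arcsin_gen p" 0 _ 1] continuous_on_arcsin_gen[OF p] by force
  moreover have "arcsin_gen p ` {0..1} \<subseteq> {0..arcsin_gen p 1}"
    using mono[of 0] mono[of _ 1] by auto
  ultimately show ?thesis
    using strict_mono_on_imp_inj_on[OF strict_mono_on_arcsin_gen[OF p]]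
    by (auto simp: bij_betw_def pi_gen_def)
qed

section \<open>The inverse function and its derivative\<close>

lemma sin_gen_mem:
  assumes "1 < p" "y \<in> {0..pi_gen p / 2}"
  shows "sin_gen p y \<in> {0..1}"
  using inv_into_into[of y "arcsin_gen p" "{0..1}"] bij_betw_imp_surj_on[OF bij_betw_arcsin_gen] assms
  by (simp add: sin_gen_def)

lemma arcsin_gen_sin_gen:
  assumes "1 < p" "y \<in> {0..pi_gen p / 2}"
  shows "arcsin_gen p (sin_gen p y) = y"
  using f_inv_into_f[of y "arcsin_gen p" "{0..1}"] bij_betw_imp_surj_on[OF bij_betw_arcsin_gen] assms
  by (simp add: sin_gen_def)

lemma continuous_on_sin_gen:
  assumes p: "1 < p"
  shows "continuous_on {0..pi_gen p / 2} (sin_gen p)"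
proof -
  have "continuous_on (arcsin_gen p ` {0..1}) (inv_into {0..1} (arcsin_gen p))"
    using bij_betw_arcsin_gen[OF p] continuous_on_arcsin_gen[OF p]
    by (intro continuous_on_inv) (auto simp: bij_betw_def)
  then show ?thesis
    using bij_betw_arcsin_gen[OF p] by (simp add: sin_gen_def bij_betw_def)
qed

text \<open>Since \<open>z - y\<close> is a difference of values of \<open>arcsin_gen\<close>, this
  is \<open>arcsin_gen_diff_bounds\<close> solved for the reciprocal quotient.\<close>

lemma sin_gen_diff_quotient_bounds:
  assumes p: "1 < p" and y: "0 \<le> y" "y < z" "z \<le> pi_gen p / 2"
  shows "(sin_gen p z - sin_gen p y) / (z - y)
    \<in> {cosine_of_sine p (sin_gen p z)..cosine_of_sine p (sin_gen p y)}"
proof -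
  have eqs: "arcsin_gen p (sin_gen p y) = y" "arcsin_gen p (sin_gen p z) = z"
    using y p by (auto intro!: arcsin_gen_sin_gen)
  have mem: "sin_gen p y \<in> {0..1}" "sin_gen p z \<in> {0..1}"
    using y p by (auto intro!: sin_gen_mem simp del: atLeastAtMost_iff) auto
  have "sin_gen p y < sin_gen p z"
    using strict_mono_on_less[OF strict_mono_on_arcsin_gen[OF p] mem] eqs y by simp
  then show ?thesis
    using arcsin_gen_diff_bounds[OF p, of "sin_gen p y" "sin_gen p z"] mem eqs y
    by (simp add: field_simps)
qed

text \<open>The inverse function rule would fail at \<open>x = pi_gen p / 2\<close>, where the
  cosine vanishes. Squeezing the difference quotients treats this endpoint like every other
  point.\<close>

lemma cos_gen_eq:
  assumes p: "1 < p" and x: "x \<in> {0<..pi_gen p / 2}"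
  shows "cos_gen p x = cosine_of_sine p (sin_gen p x)"
proof -
  let ?I = "{0..pi_gen p / 2}"
  let ?c = "\<lambda>y. cosine_of_sine p (sin_gen p y)"
  have "continuous_on ?I ?c"
    using p sin_gen_mem[OF p]
    by (intro continuous_on_compose2[OF continuous_on_cosine_of_sine[OF p] continuous_on_sin_gen]) auto
  then have lim: "(?c \<longlongrightarrow> ?c x) (at x within ?I)"
    using x by (auto simp: continuous_on_def)
  \<comment> \<open>\<open>min\<close> and \<open>max\<close> cover \<open>y < x\<close> and
    \<open>x < y\<close> by one pair of bounds.\<close>
  have bounds: "(sin_gen p y - sin_gen p x) / (y - x) \<in> {min (?c x) (?c y)..max (?c x) (?c y)}"
    if "y \<in> ?I" "y \<noteq> x" for y
  proof (cases "x < y")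
    case True
    then show ?thesis
      using sin_gen_diff_quotient_bounds[OF p, of x y] x that by auto
  next
    case False
    have "(sin_gen p y - sin_gen p x) / (y - x) = (sin_gen p x - sin_gen p y) / (x - y)"
      by (metis minus_diff_eq minus_divide_divide)
    then show ?thesis
      using False sin_gen_diff_quotient_bounds[OF p, of y x] x that by auto
  qed
  have "((\<lambda>y. (sin_gen p y - sin_gen p x) / (y - x)) \<longlongrightarrow> ?c x) (at x within ?I)"
  proof (rule tendsto_sandwich)
    show "((\<lambda>y. min (?c x) (?c y)) \<longlongrightarrow> ?c x) (at x within ?I)"
      using tendsto_min[OF tendsto_const lim, of "?c x"] by simp
    show "((\<lambda>y. max (?c x) (?c y)) \<longlongrightarrow> ?c x) (at x within ?I)"
      using tendsto_max[OF tendsto_const lim, of "?c x"] by simp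
  qed (use bounds in \<open>auto simp: eventually_at_filter\<close>)
  then have "(sin_gen p has_vector_derivative ?c x) (at x within ?I)"
    by (simp add: has_field_derivative_iff flip: has_real_derivative_iff_has_vector_derivative)
  then show ?thesis
    \<comment> \<open>As \<open>x > 0\<close>, the interval is nondegenerate, so the derivative
      within it is unique.\<close>
    using x unfolding cos_gen_def
    by (intro vector_derivative_within_closed_interval) auto
qed

section \<open>The inequality between arcsine and cosine\<close>

lemma cosine_polynomial_bound:
  fixes c p :: real
  assumes p: "1 < p" "p \<le> 2" and c: "0 < c" "c < 1"
  shows "(1 + p) * (p * c + c powr (2 - p)) < (c + p)\<^sup>2"
proof -
  \<comment> \<open>Young's inequality for \<open>c\<close> and \<open>1\<close> with weights
    \<open>2 - p\<close> and \<open>p - 1\<close> is the Bernoulli bound; the factor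
    \<open>1 powr (p - 1)\<close> only supplies the required shape.\<close>
  have "c powr (2 - p) * 1 powr (p - 1) \<le> (2 - p) * c + (p - 1) * 1"
    using p c by (intro Youngs_inequality_0) auto
  then have "(1 + p) * (p * c + c powr (2 - p)) \<le> (1 + p) * (p * c + ((2 - p) * c + (p - 1)))"
    using p by (intro mult_left_mono) auto
  moreover have "(c + p)\<^sup>2 - (1 + p) * (p * c + ((2 - p) * c + (p - 1))) = (1 - c)\<^sup>2"
    by (simp add: power2_eq_square algebra_simps)
  moreover have "0 < (1 - c)\<^sup>2"
    using c by simp
  ultimately show ?thesis by linarith
qed

text \<open>As \<open>1 / p - 1 = (1 - p) / p\<close>, the outer factor of the chain rule is a power
  of the cosine itself, so the derivative can be handled in terms of \<open>c\<close>.\<close>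

lemma DERIV_cosine_of_sine:
  assumes p: "1 < p" and s: "0 < s" "s < 1"
  shows "(cosine_of_sine p has_real_derivative - (s powr (p - 1) * cosine_of_sine p s powr (1 - p))) (at s)"
proof -
  have pos: "0 < 1 - s powr p"
    using powr_less_mono2[of p s 1] p s by simp
  have "cosine_of_sine p s powr (1 - p) = (1 - s powr p) powr (1 / p - 1)"
    using p by (simp add: cosine_of_sine_def powr_powr field_simps)
  then show ?thesis
    unfolding cosine_of_sine_def[abs_def] using p s pos
    by (auto intro!: derivative_eq_intros simp: field_simps)
qed

text \<open>Both sides vanish at 0. Their derivatives are compared only on the open interval, so
  continuity covers \<open>s = 1\<close>, where the arcsine has no finite slope.\<close>

lemma arcsin_gen_lower_bound:
  assumes p: "1 < p" "p \<le> 2" and s: "0 < s" "s \<le> 1"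
  shows "(1 + p) * s / (cosine_of_sine p s + p) < arcsin_gen p s"
proof -
  let ?c = "cosine_of_sine p"
  let ?F = "\<lambda>t. arcsin_gen p t - (1 + p) * t / (?c t + p)"
  have den: "0 < ?c t + p" for t
    using cosine_of_sine_nonneg[of p t] p by linarith
  have "?F 0 < ?F s"
  proof (rule DERIV_pos_imp_increasing_open[OF \<open>0 < s\<close>])
    show "continuous_on {0..s} ?F"
      using s p den
      by (intro continuous_intros continuous_on_subset[OF continuous_on_cosine_of_sine]
          continuous_on_subset[OF continuous_on_arcsin_gen]) (auto simp: less_imp_neq[symmetric])
    fix t assume t: "0 < t" "t < s"
    then have t1: "t < 1" using s by simp
    define c where "c = ?c t"
    have c: "0 < c" "c < 1"
      using cosine_of_sine_pos[of p t] cosine_of_sine_less_one[of p t] p t t1 by (auto simp: c_def)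
    \<comment> \<open>The derivative of the cosine at \<open>t\<close> is \<open>- d\<close>; the
      product \<open>t * d\<close> depends on \<open>c\<close> alone, because
      \<open>t * t powr (p - 1) = 1 - c powr p\<close>.\<close>
    define d where "d = t powr (p - 1) * c powr (1 - p)"
    have "c powr p = 1 - t powr p"
      using p t t1 powr_le_one[of t p] by (simp add: c_def cosine_of_sine_def powr_powr)
    then have "t * d = (1 - c powr p) * c powr (1 - p)"
      using t by (simp add: d_def powr_mult_base)
    also have "\<dots> = c powr (1 - p) - c"
      using c by (simp add: algebra_simps flip: powr_add)
    finally have td: "t * d = c powr (1 - p) - c" .
    let ?D = "inverse c - (1 + p) * (c + p + t * d) / (c + p)\<^sup>2"
    have "(?F has_real_derivative ?D) (at t)"
    proof -
      have "(?F has_real_derivative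
          inverse c - ((1 + p) * (c + p) - (1 + p) * t * (- d)) / ((c + p) * (c + p))) (at t)"
        using DERIV_arcsin_gen[OF p(1) t(1) t1] DERIV_cosine_of_sine[OF p(1) t(1) t1] den[of t]
        by (auto intro!: derivative_eq_intros simp: c_def d_def)
      then show ?thesis
        by (simp add: power2_eq_square algebra_simps)
    qed
    moreover have "0 < ?D"
    proof -
      \<comment> \<open>Multiplying by \<open>c\<close> clears \<open>inverse c\<close> and turns
        \<open>c powr (1 - p)\<close> into \<open>c powr (2 - p)\<close>; the two terms
        \<open>c * c\<close> cancel.\<close>
      have "c * (c + p + t * d) = p * c + c powr (2 - p)"
        using c powr_mult_base[of c "1 - p"] unfolding td by (simp add: algebra_simps)
      then have "c * ((1 + p) * (c + p + t * d)) < (c + p)\<^sup>2"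
        using cosine_polynomial_bound[OF p c] by (metis mult.left_commute)
      then show ?thesis
        using c p by (simp add: field_simps)
    qed
    ultimately show "\<exists>y. (?F has_real_derivative y) (at t) \<and> 0 < y"
      by blast
  qed
  then show ?thesis by simp
qed

theorem theorem3p22:
  fixes p x :: real
  assumes "p \<in> {1<..2}" and "x \<in> {0<..pi_gen p / 2}"
  shows "sin_gen p x / x < (cos_gen p x + p) / (1 + p) \<and>
         (cos_gen p x + p) / (1 + p) \<le> (cos_gen p x + 2) / 3"
proof -
  have p: "1 < p" "p \<le> 2" and x: "0 < x" and xI: "x \<in> {0..pi_gen p / 2}"
    using assms by auto
  define s where "s = sin_gen p x"
  define c where "c = cosine_of_sine p s"
  have cos: "cos_gen p x = c"
    using cos_gen_eq[OF p(1) assms(2)] by (simp add: c_def s_def)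
  have arcsin: "arcsin_gen p s = x"
    unfolding s_def using arcsin_gen_sin_gen[OF p(1) xI] .
  then have s: "0 < s" "s \<le> 1"
    using sin_gen_mem[OF p(1) xI] x by (auto simp: s_def less_le)
  have c: "0 \<le> c" "c < 1"
    using cosine_of_sine_nonneg cosine_of_sine_less_one[OF p(1) s] by (auto simp: c_def)
  have "(1 + p) * s / (c + p) < x"
    using arcsin_gen_lower_bound[OF p s] by (simp add: arcsin c_def)
  then have "s / x < (c + p) / (1 + p)"
    using c p x by (simp add: field_simps)
  \<comment> \<open>After clearing denominators, the right side minus the left side of the second
    inequality is exactly this product.\<close>
  moreover have "0 \<le> (2 - p) * (1 - c)"
    using p c by simp
  then have "(c + p) / (1 + p) \<le> (c + 2) / 3"
    using p by (simp add: field_simps)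
  ultimately show ?thesis
    by (simp add: cos s_def)
qed

end
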